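(* Let $n\ge 1$. The number of Markov equivalence classes of directed acyclic graphs on the labeled vertex set $\{1,\dots,n\}$ that consist of exactly one directed acyclic graph equals $$\sum_{P}\ \prod_{v\in P}\left(2^{d(v)-c(v)}-1_{c(v)=1}\right),$$ where the sum is over all labeled posets $P$ on $\{1,\dots,n\}$ (all partial orders on this set), $d(v)$ is the number of elements strictly below $v$ in $P$, $c(v)$ is the number of elements covered by $v$ in $P$, and $1_{c(v)=1}$ equals $1$ if $c(v)=1$ and $0$ otherwise.
   Context: A DAG is a directed graph (no loops or multiple edges) with no directed cycle. The skeleton of a DAG is the underlying undirected graph. A $v$-structure (immorality) is a triple of vertices $a,b,c$ with directed edges $a\to c$ and $b\to c$ such that $a$ and $b$ are not adjacent. Two DAGs on the same vertex set are Markov equivalent if they have the same skeleton and the same $v$-structures; Markov equivalence classes are the classes of this relation. In a poset, $v$ covers $u$ if $u<v$ and there is no $z$ with $u<z<v$. *)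

theory Defs
  imports Main
begin

text \<open>A digraph on {1..n} without multiple edges is its edge relation;
  \<^const>\<open>acyclic\<close> also excludes loops.\<close>

definition dags :: "nat \<Rightarrow> nat rel set" where
  "dags n = {D. D \<subseteq> {1..n} \<times> {1..n} \<and> acyclic D}"

text \<open>Undirected graphs are represented by symmetric relations.\<close>

definition skeleton :: "'a rel \<Rightarrow> 'a rel" where
  "skeleton D = D \<union> D\<inverse>"

text \<open>The vertices of a v-structure are distinct. The condition \<open>a \<noteq> b\<close> has to be explicit:
  no vertex is adjacent to itself, so otherwise every edge would yield a degenerate triple
  \<open>(a, a, c)\<close>.\<close>

definition v_structures :: "'a rel \<Rightarrow> ('a \<times> 'a \<times> 'a) set" where
  "v_structures D =
     {(a, b, c). a \<noteq> b \<and> (a, c) \<in> D \<and> (b, c) \<in> D \<and> (a, b) \<notin> skeleton D}"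

definition markov_equiv :: "nat \<Rightarrow> (nat rel \<times> nat rel) set" where
  "markov_equiv n =
     {(D, E). D \<in> dags n \<and> E \<in> dags n \<and>
        skeleton D = skeleton E \<and> v_structures D = v_structures E}"

definition markov_classes :: "nat \<Rightarrow> nat rel set set" where
  "markov_classes n = dags n // markov_equiv n"

text \<open>Posets are reflexive partial orders; \<open>(u, v) \<in> P\<close> means \<open>u \<le> v\<close>, so that
  \<^term>\<open>underS P v\<close> is the set of elements strictly below \<open>v\<close>.\<close>

definition posets :: "nat \<Rightarrow> nat rel set" where
  "posets n = {P. partial_order_on {1..n} P}"

definition covered_by :: "'a rel \<Rightarrow> 'a \<Rightarrow> 'a set" where
  "covered_by P v =
     {u \<in> underS P v. \<not> (\<exists>z \<in> underS P v. u \<in> underS P z)}"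

lemma equiv_markov_equiv: "equiv (dags n) (markov_equiv n)"
  by (auto simp: equiv_def refl_on_def sym_def trans_def markov_equiv_def)

lemma finite_dags: "finite (dags n)"
  by (rule finite_subset[of _ "Pow ({1..n} \<times> {1..n})"]) (auto simp: dags_def)

lemma finite_posets: "finite (posets n)"
  by (rule finite_subset[of _ "Pow ({1..n} \<times> {1..n})"])
     (auto simp: posets_def partial_order_on_def preorder_on_def)

lemma card_covered_by_le:
  assumes "P \<in> posets n"
  shows "card (covered_by P v) \<le> card (underS P v)"
proof (rule card_mono)
  have "P \<subseteq> {1..n} \<times> {1..n}"
    using assms by (auto simp: posets_def partial_order_on_def preorder_on_def)
  then have "underS P v \<subseteq> {1..n}"
    by (auto simp: underS_def)
  then show "finite (underS P v)"
    by (rule finite_subset) simp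
qed (auto simp: covered_by_def)

end

theory Submission
  imports Defs "HOL-Library.FuncSet"
begin

text \<open>By Chickering's covered edge reversals, a DAG is alone in its Markov equivalence class iff
  it has no covered edge, i.e. no edge \<open>a \<rightarrow> b\<close> such that the parents of \<open>b\<close> are \<open>a\<close> and the
  parents of \<open>a\<close>. Group these DAGs by the partial order \<open>P\<close> that they generate. A DAG generates
  \<open>P\<close> iff the parents of each vertex \<open>v\<close> lie strictly below \<open>v\<close> and include all elements covered
  by \<open>v\<close>, which leaves \<open>2^(d(v) - c(v))\<close> parent sets. An edge \<open>u \<rightarrow> v\<close> can be a covered edge only
  if \<open>u\<close> is the unique element covered by \<open>v\<close>; then exactly one of these parent sets is forbidden.
  Which one depends on the parents of \<open>u\<close>, but the number of choices does not.\<close>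

definition covered_edge :: "'a rel \<Rightarrow> 'a \<Rightarrow> 'a \<Rightarrow> bool" where
  "covered_edge D a b \<longleftrightarrow> (a, b) \<in> D \<and> D\<inverse> `` {b} = insert a (D\<inverse> `` {a})"


section \<open>Covered edges and Markov equivalence\<close>

lemma acyclic_not_sym: "acyclic D \<Longrightarrow> (a, b) \<in> D \<Longrightarrow> (b, a) \<notin> D"
  by (meson acyclic_def trancl.r_into_trancl trancl_into_trancl)

lemma acyclic_no_triangle: "acyclic D \<Longrightarrow> (a, b) \<in> D \<Longrightarrow> (b, c) \<in> D \<Longrightarrow> (c, a) \<notin> D"
  unfolding acyclic_def by (metis trancl.r_into_trancl trancl.trancl_into_trancl)

text \<open>Since \<open>a\<close> and \<open>b\<close> have the same parents apart from the edge
  itself, every other parent of either one is adjacent to both. Hence neither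
  \<open>a \<rightarrow> b\<close> before the reversal nor \<open>b \<rightarrow> a\<close> after it
  can take part in an unshielded collider.\<close>

lemma covered_edge_reversal:
  assumes "acyclic D" and cov: "covered_edge D a b"
  defines "E \<equiv> insert (b, a) (D - {(a, b)})"
  shows "acyclic E" "skeleton E = skeleton D" "v_structures E = v_structures D"
proof -
  have ab: "(a, b) \<in> D" and par: "(c, b) \<in> D \<longleftrightarrow> c = a \<or> (c, a) \<in> D" for c
    using cov by (auto simp: covered_edge_def)
  have asym: "(x, y) \<in> D \<Longrightarrow> (y, x) \<notin> D" for x y
    using acyclic_not_sym[OF \<open>acyclic D\<close>] .
  have neq: "a \<noteq> b"
    using ab asym by blast
  \<comment> \<open>The new edge \<open>(b, a)\<close> closes a cycle only if another path leads
    from \<open>a\<close> to \<open>b\<close>. The last edge of such a path would start at a parent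
    \<open>c\<close> of \<open>b\<close> with \<open>c \<rightarrow> a\<close>, so the path up to
    \<open>c\<close> would already close a cycle in \<open>D\<close>.\<close>
  have "(a, b) \<notin> (D - {(a, b)})\<^sup>*"
  proof
    assume "(a, b) \<in> (D - {(a, b)})\<^sup>*"
    then obtain c where ac: "(a, c) \<in> (D - {(a, b)})\<^sup>*" and cb: "(c, b) \<in> D - {(a, b)}"
      using neq by (meson rtranclE)
    have "(a, c) \<in> D\<^sup>*"
      using ac rtrancl_mono[of "D - {(a, b)}" D] by blast
    moreover have "(c, a) \<in> D"
      using cb par by blast
    ultimately have "(a, a) \<in> D\<^sup>+"
      by (rule rtrancl_into_trancl1)
    then show False
      using \<open>acyclic D\<close> by (simp add: acyclic_def)
  qed
  moreover have "acyclic (D - {(a, b)})"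
    using \<open>acyclic D\<close> by (rule acyclic_subset) blast
  ultimately show "acyclic E"
    by (simp add: E_def)
  show skel: "skeleton E = skeleton D"
    using ab by (auto simp: skeleton_def E_def)
  have "(x, z) \<in> E \<and> (y, z) \<in> E \<longleftrightarrow> (x, z) \<in> D \<and> (y, z) \<in> D"
    if "x \<noteq> y" "(x, y) \<notin> skeleton D" for x y z
  proof -
    have "(x, y) \<notin> D" "(y, x) \<notin> D"
      using that(2) by (auto simp: skeleton_def)
    then show ?thesis
      using ab par[of x] par[of y] asym[OF ab] neq \<open>x \<noteq> y\<close> unfolding E_def
      by (cases "x = a"; cases "y = a"; cases "z = a"; cases "z = b") auto
  qed
  then show "v_structures E = v_structures D"
    unfolding v_structures_def skel by auto
qed

text \<open>Among the edges of \<open>D\<close> that \<open>E\<close> reverses, take one whose head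
  \<open>b\<close> is minimal in \<open>D\<close> and then, for this \<open>b\<close>, one whose
  tail \<open>a\<close> is maximal in \<open>D\<close>. Minimality means that \<open>E\<close> keeps
  every edge of \<open>D\<close> into a parent of \<open>b\<close>. A violation of coveredness then
  forces a v-structure in only one of the graphs, a cycle, or a contradiction to one of the two
  choices.\<close>

lemma covered_edge_exists:
  assumes "finite D" "acyclic D" "acyclic E" "D \<noteq> E"
    and skel: "skeleton D = skeleton E" and vs: "v_structures D = v_structures E"
  obtains a b where "covered_edge D a b"
proof -
  have adj: "(x, y) \<in> D \<or> (y, x) \<in> D \<longleftrightarrow> (x, y) \<in> E \<or> (y, x) \<in> E" for x y
    using skel unfolding skeleton_def by blast
  have vD: "(x, z) \<in> E \<and> (y, z) \<in> E \<longleftrightarrow> (x, z) \<in> D \<and> (y, z) \<in> D"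
    if "x \<noteq> y" "(x, y) \<notin> D" "(y, x) \<notin> D" for x y z
  proof -
    have "(x, y, z) \<in> v_structures D \<longleftrightarrow> (x, y, z) \<in> v_structures E"
      using vs by simp
    then show ?thesis
      using that skel by (auto simp: v_structures_def skeleton_def)
  qed
  note asymD = acyclic_not_sym[OF \<open>acyclic D\<close>] and asymE = acyclic_not_sym[OF \<open>acyclic E\<close>]
  note triD = acyclic_no_triangle[OF \<open>acyclic D\<close>] and triE = acyclic_no_triangle[OF \<open>acyclic E\<close>]
  have wf: "wf D" "wf (D\<inverse>)"
    using finite_acyclic_wf[OF \<open>finite D\<close> \<open>acyclic D\<close>]
      finite_acyclic_wf_converse[OF \<open>finite D\<close> \<open>acyclic D\<close>] by auto
  \<comment> \<open>If the difference appears as an edge of \<open>E\<close> outside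
    \<open>D\<close>, its reversal lies in \<open>D\<close> by the common skeleton, and outside
    \<open>E\<close> by acyclicity.\<close>
  have "\<exists>a0 b0. (a0, b0) \<in> D \<and> (a0, b0) \<notin> E"
    using \<open>D \<noteq> E\<close> adj asymD asymE by (metis subrelI subset_antisym)
  then obtain b0 where "b0 \<in> {b. \<exists>a. (a, b) \<in> D - E}"
    by blast
  then obtain b where "b \<in> {b. \<exists>a. (a, b) \<in> D - E}"
    and bmin: "\<And>y. (y, b) \<in> D \<Longrightarrow> y \<notin> {b. \<exists>a. (a, b) \<in> D - E}"
    by (rule wfE_min[OF wf(1)]) blast
  then obtain a0 where "a0 \<in> {a. (a, b) \<in> D - E}"
    by blast
  then obtain a where a: "a \<in> {a. (a, b) \<in> D - E}"
    and amax: "\<And>y. (y, a) \<in> D\<inverse> \<Longrightarrow> y \<notin> {a. (a, b) \<in> D - E}"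
    by (rule wfE_min[OF wf(2)]) blast
  have ab: "(a, b) \<in> D" "(b, a) \<in> E"
    using a adj by auto
  have "(c, b) \<in> D" if ca: "(c, a) \<in> D" for c
  proof -
    have "(c, a) \<in> E"
      using bmin[OF ab(1)] ca by blast
    moreover have "c \<noteq> b"
      using ca ab(1) asymD by blast
    \<comment> \<open>Otherwise \<open>c \<rightarrow> a \<leftarrow> b\<close> would be a
      v-structure of \<open>E\<close>, but \<open>D\<close> has
      \<open>a \<rightarrow> b\<close>.\<close>
    ultimately have "(c, b) \<in> D \<or> (b, c) \<in> D"
      using vD[of b c a] ab asymD by blast
    then show ?thesis
      using triD[OF ca ab(1)] by blast
  qed
  moreover have "(c, a) \<in> D" if cb: "(c, b) \<in> D" and "c \<noteq> a" for c
  proof (rule ccontr)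
    assume nca: "(c, a) \<notin> D"
    \<comment> \<open>Otherwise \<open>c \<rightarrow> b \<leftarrow> a\<close> would be a
      v-structure of \<open>D\<close> that \<open>E\<close> destroys by reversing
      \<open>a \<rightarrow> b\<close>.\<close>
    have "(c, a) \<in> D \<or> (a, c) \<in> D"
      using vD[of c a b] cb ab asymE \<open>c \<noteq> a\<close> by blast
    then have ac: "(a, c) \<in> D"
      using nca by blast
    \<comment> \<open>With \<open>a \<rightarrow> c\<close>, maximality of \<open>a\<close>
      preserves \<open>c \<rightarrow> b\<close> in \<open>E\<close>. As \<open>E\<close> also has
      \<open>b \<rightarrow> a\<close>, it must reverse \<open>a \<rightarrow> c\<close>; then
      \<open>c\<close> is the head of a reversed edge and precedes \<open>b\<close>, against
      minimality of \<open>b\<close>.\<close>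
    then have "(c, b) \<in> E"
      using amax cb by blast
    then have "(a, c) \<notin> E"
      using triE ab(2) by blast
    then show False
      using bmin[OF cb] ac by blast
  qed
  ultimately have "covered_edge D a b"
    using ab by (auto simp: covered_edge_def)
  then show thesis ..
qed

lemma singleton_markov_class_iff:
  assumes D: "D \<in> dags n"
  shows "markov_equiv n `` {D} = {D} \<longleftrightarrow> (\<forall>a b. \<not> covered_edge D a b)"
proof
  assume single: "markov_equiv n `` {D} = {D}"
  show "\<forall>a b. \<not> covered_edge D a b"
  proof (intro allI notI)
    fix a b
    assume cov: "covered_edge D a b"
    let ?E = "insert (b, a) (D - {(a, b)})"
    have acyc: "acyclic D" and sub: "D \<subseteq> {1..n} \<times> {1..n}"
      using D by (auto simp: dags_def)
    have "(D, ?E) \<in> markov_equiv n"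
      using covered_edge_reversal[OF acyc cov] D sub cov
      by (auto simp: markov_equiv_def dags_def covered_edge_def)
    then have "?E \<in> markov_equiv n `` {D}"
      by (rule ImageI) simp
    then have "?E = D"
      unfolding single by (rule singletonD)
    moreover have "(b, a) \<notin> D"
      using acyclic_not_sym[OF acyc] cov by (auto simp: covered_edge_def)
    ultimately show False
      by blast
  qed
next
  assume nc: "\<forall>a b. \<not> covered_edge D a b"
  have "E = D" if "(D, E) \<in> markov_equiv n" for E
  proof (rule ccontr)
    assume "E \<noteq> D"
    moreover have "finite D"
      using D by (auto simp: dags_def intro: finite_subset)
    ultimately show False
      using that nc covered_edge_exists[of D E] by (auto simp: markov_equiv_def dags_def)
  qed
  moreover have "(D, D) \<in> markov_equiv n"
    using D by (simp add: markov_equiv_def)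
  ultimately show "markov_equiv n `` {D} = {D}"
    by blast
qed

lemma card_singleton_markov_classes:
  "card {C \<in> markov_classes n. card C = 1} =
    card {D \<in> dags n. \<forall>a b. \<not> covered_edge D a b}" (is "card ?L = card ?R")
proof -
  have "?L = (\<lambda>D. {D}) ` ?R"
  proof (intro equalityI subsetI)
    fix C assume "C \<in> ?L"
    then obtain D E where D: "D \<in> dags n" and C: "C = markov_equiv n `` {D}" "C = {E}"
      by (auto simp: markov_classes_def card_1_singleton_iff elim!: quotientE)
    have "D \<in> C"
      using D C(1) by (simp add: markov_equiv_def)
    then have "C = {D}"
      using C(2) by simp
    then show "C \<in> (\<lambda>D. {D}) ` ?R"
      using singleton_markov_class_iff[OF D] D C(1) by auto
  next
    fix C assume "C \<in> (\<lambda>D. {D}) ` ?R"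
    then obtain D where D: "D \<in> dags n" and "C = {D}" "markov_equiv n `` {D} = {D}"
      using singleton_markov_class_iff by auto
    then show "C \<in> ?L"
      using quotientI[OF D, of "markov_equiv n"] by (simp add: markov_classes_def)
  qed
  moreover have "inj_on (\<lambda>D. {D}) ?R"
    by (simp add: inj_on_def)
  ultimately show ?thesis
    by (simp add: card_image)
qed


section \<open>DAGs generating a given partial order\<close>

lemma partial_order_onD:
  assumes "partial_order_on A P"
  shows "P \<subseteq> A \<times> A" "x \<in> A \<Longrightarrow> (x, x) \<in> P"
    "(x, y) \<in> P \<Longrightarrow> (y, z) \<in> P \<Longrightarrow> (x, z) \<in> P"
    "(x, y) \<in> P \<Longrightarrow> (y, x) \<in> P \<Longrightarrow> x = y"
  using assms
  by (auto simp: partial_order_on_def preorder_on_def refl_on_def antisym_def dest: transD)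

lemma acyclic_strict_order:
  assumes "partial_order_on A P"
  shows "acyclic (P - Id)"
proof -
  have "trans (P - Id)"
    using assms by (auto simp: partial_order_on_def preorder_on_def intro: trans_diff_Id)
  then show ?thesis
    by (auto intro: acyclicI_order simp: acyclic_def)
qed

lemma finite_underS:
  assumes "finite A" "partial_order_on A P"
  shows "finite (underS P v)"
  using assms(1)
  by (rule finite_subset[rotated]) (use partial_order_onD(1)[OF assms(2)] in \<open>auto simp: underS_def\<close>)

lemma covered_by_subset: "covered_by P v \<subseteq> underS P v"
  by (auto simp: covered_by_def)

text \<open>Finiteness gives a maximal element of the half-open interval from \<open>u\<close> up to
  but excluding \<open>v\<close>, and nothing fits between it and \<open>v\<close>.\<close>

lemma underS_below_covered:
  assumes "finite A" and po: "partial_order_on A P" and u: "u \<in> underS P v"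
  obtains z where "z \<in> covered_by P v" "(u, z) \<in> P"
proof -
  note P = partial_order_onD[OF po]
  have "finite P"
    using P(1) \<open>finite A\<close> by (meson finite_SigmaI finite_subset)
  then have "wf ((P - Id)\<inverse>)"
    using acyclic_strict_order[OF po] by (intro finite_acyclic_wf_converse) auto
  moreover have "u \<in> {z \<in> underS P v. (u, z) \<in> P}"
    using u P by (auto simp: underS_def)
  ultimately obtain z where z: "z \<in> {z \<in> underS P v. (u, z) \<in> P}"
    and zmax: "\<And>y. (y, z) \<in> (P - Id)\<inverse> \<Longrightarrow> y \<notin> {z \<in> underS P v. (u, z) \<in> P}"
    by (rule wfE_min) blast
  have "z \<in> covered_by P v"
    unfolding covered_by_def
  proof (intro CollectI conjI notI)
    show "z \<in> underS P v"
      using z by simp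
    assume "\<exists>y\<in>underS P v. z \<in> underS P y"
    then obtain y where "y \<in> underS P v" "(z, y) \<in> P - Id"
      by (auto simp: underS_def)
    then show False
      using z zmax[of y] P(3)[of u z y] by simp
  qed
  then show thesis
    using that z by blast
qed

text \<open>The generating DAGs are those between the Hasse diagram and the strict order. Written
  vertex by vertex, this turns a condition on a transitive closure into separate conditions on the
  parent sets.\<close>

lemma generates_order_iff:
  assumes "finite A" and po: "partial_order_on A P" and "D \<subseteq> A \<times> A"
  shows "acyclic D \<and> Id_on A \<union> D\<^sup>+ = P \<longleftrightarrow>
    (\<forall>v\<in>A. covered_by P v \<subseteq> D\<inverse> `` {v} \<and> D\<inverse> `` {v} \<subseteq> underS P v)" (is "?L \<longleftrightarrow> ?R")
proof
  assume L: ?L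
  then have irr: "(x, x) \<notin> D\<^sup>+" for x
    by (simp add: acyclic_def)
  have underS: "underS P v = {u. (u, v) \<in> D\<^sup>+}" for v
    using L irr by (auto simp: underS_def)
  show ?R
  proof (intro ballI conjI subsetI)
    fix v u assume u: "u \<in> covered_by P v"
    then have "(u, v) \<in> D\<^sup>+"
      by (simp add: covered_by_def underS)
    \<comment> \<open>The last edge of a longer path from \<open>u\<close> to \<open>v\<close> would
      start strictly between them, so a covered element must be joined to \<open>v\<close> by an
      edge.\<close>
    then show "u \<in> D\<inverse> `` {v}"
      using u by (cases rule: trancl.cases) (auto simp: covered_by_def underS)
  qed (auto simp: underS)
next
  assume R: ?R
  note P = partial_order_onD[OF po]
  have D: "D \<subseteq> P - Id"
    using R \<open>D \<subseteq> A \<times> A\<close> by (fastforce simp: underS_def)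
  then have "acyclic D"
    using acyclic_strict_order[OF po] acyclic_subset by blast
  have "D\<^sup>+ \<subseteq> P"
  proof (rule subrelI)
    fix x y assume "(x, y) \<in> D\<^sup>+"
    then show "(x, y) \<in> P"
      by induction (use D P(3) in blast)+
  qed
  have "finite P"
    using P(1) \<open>finite A\<close> by (meson finite_SigmaI finite_subset)
  then have wf: "wf (P - Id)"
    using acyclic_strict_order[OF po] by (intro finite_acyclic_wf) auto
  \<comment> \<open>Well-founded induction on \<open>v\<close>: the path is built backwards, from
    \<open>v\<close> to a covered element \<open>z\<close> above \<open>u\<close>, whose edge to
    \<open>v\<close> is forced by the lower bound.\<close>
  have "(u, v) \<in> D\<^sup>+" if "u \<in> underS P v" for u v
    using wf that
  proof (induction v arbitrary: u rule: wf_induct_rule)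
    case (less v)
    obtain z where z: "z \<in> covered_by P v" "(u, z) \<in> P"
      using underS_below_covered[OF \<open>finite A\<close> po less.prems] .
    have "v \<in> A"
      using less.prems P(1) by (auto simp: underS_def)
    then have "(z, v) \<in> D"
      using R z(1) by blast
    show ?case
    proof (cases "u = z")
      case True
      then show ?thesis
        using \<open>(z, v) \<in> D\<close> by blast
    next
      case False
      then have "(u, z) \<in> D\<^sup>+"
        using less.IH[of z u] z \<open>(z, v) \<in> D\<close> D by (auto simp: underS_def)
      then show ?thesis
        using \<open>(z, v) \<in> D\<close> by (rule trancl_into_trancl)
    qed
  qed
  then have "(u, v) \<in> Id_on A \<union> D\<^sup>+" if "(u, v) \<in> P" for u v
    using that P(1) by (cases "u = v") (auto simp: underS_def)
  then have "P \<subseteq> Id_on A \<union> D\<^sup>+"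
    by (rule subrelI)
  then show ?L
    using \<open>acyclic D\<close> \<open>D\<^sup>+ \<subseteq> P\<close> P(2) by (auto simp: Id_on_def)
qed

lemma partial_order_on_generated:
  assumes "D \<subseteq> A \<times> A" "acyclic D"
  shows "partial_order_on A (Id_on A \<union> D\<^sup>+)"
proof -
  have "D\<^sup>+ \<subseteq> A \<times> A"
    using assms(1) by (rule trancl_subset_Sigma)
  moreover have "trans (Id_on A \<union> D\<^sup>+)"
    by (rule transI) (auto dest: trancl_trans)
  moreover have "antisym (Id_on A \<union> D\<^sup>+)"
    using assms(2) by (auto simp: antisym_def acyclic_def dest: trancl_trans)
  ultimately show ?thesis
    by (auto simp: partial_order_on_def preorder_on_def refl_on_def)
qed

text \<open>Any other element covered by \<open>v\<close> would be a parent of \<open>v\<close>,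
  hence a parent of \<open>u\<close>, hence strictly between itself and \<open>v\<close> there would
  be \<open>u\<close>. This confines the possible tail of a covered edge into \<open>v\<close> to a
  vertex determined by \<open>P\<close> alone.\<close>

lemma covered_edge_iff:
  assumes "finite A" and po: "partial_order_on A P"
    and "D \<subseteq> A \<times> A" and acyc: "acyclic D" and "Id_on A \<union> D\<^sup>+ = P"
  shows "covered_edge D u v \<longleftrightarrow>
    covered_by P v = {u} \<and> D\<inverse> `` {v} = insert u (D\<inverse> `` {u})"
proof -
  have R: "covered_by P w \<subseteq> D\<inverse> `` {w}" "D\<inverse> `` {w} \<subseteq> underS P w" if "w \<in> A" for w
    using that assms generates_order_iff[of A P D] by auto
  show ?thesis
  proof
    assume "covered_edge D u v"
    then have uv: "(u, v) \<in> D" and par: "D\<inverse> `` {v} = insert u (D\<inverse> `` {u})"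
      by (auto simp: covered_edge_def)
    then have A: "u \<in> A" "v \<in> A"
      using \<open>D \<subseteq> A \<times> A\<close> by auto
    have u: "u \<in> underS P v"
      using R(2)[OF A(2)] uv by blast
    have "w = u" if "w \<in> covered_by P v" for w
    proof (rule ccontr)
      assume "w \<noteq> u"
      then have "w \<in> underS P u"
        using that R(1)[OF A(2)] R(2)[OF A(1)] par by blast
      then show False
        using that u by (auto simp: covered_by_def)
    qed
    moreover have "covered_by P v \<noteq> {}"
      using underS_below_covered[OF \<open>finite A\<close> po u] by blast
    ultimately show "covered_by P v = {u} \<and> D\<inverse> `` {v} = insert u (D\<inverse> `` {u})"
      using par by blast
  qed (auto simp: covered_edge_def)
qed


section \<open>Counting parent sets\<close>

text \<open>A multiplication rule for choices made along an acyclic dependency \<open>r\<close>: the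
  available sets may depend on earlier choices, but their sizes may not. Removing an
  \<open>r\<close>-maximal vertex \<open>m\<close> leaves a smaller instance, since no set of
  choices depends on the value at \<open>m\<close>.\<close>

lemma card_dependent_choices:
  fixes X :: "'a \<Rightarrow> ('a \<Rightarrow> 'b) \<Rightarrow> 'b set"
  assumes "finite A" "acyclic r"
    and "\<And>v f. v \<in> A \<Longrightarrow> finite (X v f)"
    and "\<And>v f. v \<in> A \<Longrightarrow> card (X v f) = k v"
    and "\<And>v f g. v \<in> A \<Longrightarrow> (\<And>u. u \<in> A \<Longrightarrow> (u, v) \<in> r \<Longrightarrow> f u = g u) \<Longrightarrow> X v f = X v g"
  shows "finite {f \<in> extensional A. \<forall>v\<in>A. f v \<in> X v f} \<and>
    card {f \<in> extensional A. \<forall>v\<in>A. f v \<in> X v f} = (\<Prod>v\<in>A. k v)"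
  using assms(1,3-5)
proof (induction A rule: finite_psubset_induct)
  case (psubset A)
  show ?case
  proof (cases "A = {}")
    case True
    have "{f \<in> extensional {}. \<forall>v\<in>{}. f v \<in> X v f} = {\<lambda>_. undefined}"
      by auto
    then show ?thesis
      using True by simp
  next
    case False
    \<comment> \<open>Restricting to \<open>A\<close> makes the relation finite, so that a maximal
      element exists even if \<open>r\<close> is infinite.\<close>
    have "acyclic (r \<inter> A \<times> A)"
      using \<open>acyclic r\<close> by (rule acyclic_subset) blast
    then have "wf ((r \<inter> A \<times> A)\<inverse>)"
      using \<open>finite A\<close> by (intro finite_acyclic_wf_converse) auto
    then obtain m where m: "m \<in> A" and "\<And>y. (y, m) \<in> (r \<inter> A \<times> A)\<inverse> \<Longrightarrow> y \<notin> A"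
      using False wfE_min[of "(r \<inter> A \<times> A)\<inverse>"] by (metis all_not_in_conv)
    then have mmax: "(m, v) \<notin> r" if "v \<in> A" for v
      using that by blast
    let ?B = "A - {m}"
    let ?F = "\<lambda>A. {f \<in> extensional A. \<forall>v\<in>A. f v \<in> X v f}"
    \<comment> \<open>This covers \<open>v = m\<close> as well, so the value chosen at
      \<open>m\<close> affects no set of choices in \<open>A\<close>.\<close>
    have upd: "X v (f(m := x)) = X v f" if "v \<in> A" for v f x
      using mmax[OF that] that by (intro psubset.prems(3)) auto
    have IH: "finite (?F ?B)" "card (?F ?B) = (\<Prod>v\<in>?B. k v)"
    proof -
      have "finite (?F ?B) \<and> card (?F ?B) = (\<Prod>v\<in>?B. k v)"
      proof (rule psubset.IH)
        show "?B \<subset> A"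
          using m by blast
        show "finite (X v f)" "card (X v f) = k v" if "v \<in> ?B" for v f
          using that psubset.prems(1,2) by simp_all
        fix v and f g :: "'a \<Rightarrow> 'b"
        assume "v \<in> ?B" "\<And>u. u \<in> ?B \<Longrightarrow> (u, v) \<in> r \<Longrightarrow> f u = g u"
        then show "X v f = X v g"
          using mmax by (intro psubset.prems(3)) auto
      qed
      then show "finite (?F ?B)" "card (?F ?B) = (\<Prod>v\<in>?B. k v)"
        by auto
    qed
    have bij: "bij_betw (\<lambda>(f, x). f(m := x)) (SIGMA f:?F ?B. X m f) (?F A)"
    \<comment> \<open>Resetting the value at \<open>m\<close> to \<open>undefined\<close> gives the
      unique restriction that is extensional on \<open>A - {m}\<close>.\<close>
    proof (rule bij_betw_byWitness[where f' = "\<lambda>f. (f(m := undefined), f m)"])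
      show "\<forall>p\<in>SIGMA f:?F ?B. X m f.
          (\<lambda>f. (f(m := undefined), f m)) ((\<lambda>(f, x). f(m := x)) p) = p"
        by (auto simp: extensional_def fun_eq_iff)
      show "(\<lambda>(f, x). f(m := x)) ` (SIGMA f:?F ?B. X m f) \<subseteq> ?F A"
        using m by (auto simp: upd extensional_def)
      show "(\<lambda>f. (f(m := undefined), f m)) ` ?F A \<subseteq> (SIGMA f:?F ?B. X m f)"
        using m by (auto simp: upd extensional_def split: if_splits)
    qed auto
    have "finite (SIGMA f:?F ?B. X m f)"
      using IH(1) psubset.prems(1)[OF m] by (intro finite_SigmaI)
    then have "finite (?F A)"
      using bij bij_betw_finite by blast
    moreover have "card (?F A) = card (SIGMA f:?F ?B. X m f)"
      using bij_betw_same_card[OF bij] by simp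
    then have "card (?F A) = (\<Prod>v\<in>?B. k v) * k m"
      using IH psubset.prems(1,2)[OF m] by simp
    then have "card (?F A) = (\<Prod>v\<in>A. k v)"
      using m \<open>finite A\<close> by (simp add: prod.remove[of A m] mult.commute)
    ultimately show ?thesis
      by blast
  qed
qed

section \<open>Admissible parent sets for a fixed order\<close>

lemma card_sets_between:
  assumes "finite U" "C \<subseteq> U"
  shows "card {S. C \<subseteq> S \<and> S \<subseteq> U} = 2 ^ (card U - card C)"
proof -
  have "bij_betw ((\<union>) C) (Pow (U - C)) {S. C \<subseteq> S \<and> S \<subseteq> U}"
    by (rule bij_betw_byWitness[where f' = "\<lambda>S. S - C"]) (use assms in auto)
  then have "card {S. C \<subseteq> S \<and> S \<subseteq> U} = card (Pow (U - C))"
    by (metis bij_betw_same_card)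
  also have "\<dots> = 2 ^ (card U - card C)"
    using assms by (simp add: card_Pow card_Diff_subset finite_subset)
  finally show ?thesis .
qed

text \<open>The intersection with \<^term>\<open>underS P u\<close> has no effect on the parent map of a DAG
  generating \<open>P\<close>; it makes the number of choices independent of \<open>f\<close> for arbitrary \<open>f\<close>.\<close>

definition parent_choices :: "'a rel \<Rightarrow> 'a \<Rightarrow> ('a \<Rightarrow> 'a set) \<Rightarrow> 'a set set" where
  "parent_choices P v f =
     {S. covered_by P v \<subseteq> S \<and> S \<subseteq> underS P v} -
     {insert u (f u \<inter> underS P u) | u. covered_by P v = {u}}"

text \<open>When \<open>v\<close> covers only \<open>u\<close>, the excluded set contains
  \<open>u\<close> and otherwise only elements below \<open>u\<close>, so it really is one of the
  sets between the bounds and its removal lowers the count by exactly one.\<close>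

lemma card_parent_choices:
  assumes "finite A" and po: "partial_order_on A P"
  shows "card (parent_choices P v f) =
    2 ^ (card (underS P v) - card (covered_by P v)) - (if card (covered_by P v) = 1 then 1 else 0)"
proof -
  note P = partial_order_onD[OF po]
  note card = card_sets_between[OF finite_underS[OF assms] covered_by_subset]
  show ?thesis
  proof (cases "card (covered_by P v) = 1")
    case True
    then obtain u where u: "covered_by P v = {u}"
      by (auto simp: card_1_singleton_iff)
    then have uv: "u \<in> underS P v"
      using covered_by_subset[of P v] by simp
    then have "insert u (underS P u) \<subseteq> underS P v"
      using P(3,4) by (auto simp: underS_def)
    then have "insert u (f u \<inter> underS P u) \<in> {S. covered_by P v \<subseteq> S \<and> S \<subseteq> underS P v}"
      using u by auto
    moreover have "parent_choices P v f =
        {S. covered_by P v \<subseteq> S \<and> S \<subseteq> underS P v} - {insert u (f u \<inter> underS P u)}"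
      using u by (auto simp: parent_choices_def)
    ultimately show ?thesis
      using card[of v] True by simp
  next
    case False
    then have "parent_choices P v f = {S. covered_by P v \<subseteq> S \<and> S \<subseteq> underS P v}"
      by (auto simp: parent_choices_def)
    then show ?thesis
      using card[of v] False by simp
  qed
qed

text \<open>A relation on \<open>A\<close> is determined by its parent map. The two bounds in
  \<open>parent_choices\<close> encode that \<open>P\<close> is generated; the excluded set encodes
  the absence of covered edges.\<close>

lemma bij_betw_parent_maps:
  assumes "finite A" and po: "partial_order_on A P"
  shows "bij_betw (\<lambda>D. \<lambda>v\<in>A. D\<inverse> `` {v})
    {D. D \<subseteq> A \<times> A \<and> acyclic D \<and> (\<forall>a b. \<not> covered_edge D a b) \<and> Id_on A \<union> D\<^sup>+ = P}
    {f \<in> extensional A. \<forall>v\<in>A. f v \<in> parent_choices P v f}"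
    (is "bij_betw ?par ?\<D> ?\<F>")
proof -
  note P = partial_order_onD[OF po]
  let ?dag = "\<lambda>f. {(u, v). v \<in> A \<and> u \<in> f v}"
  \<comment> \<open>Thus the restricted parent map takes a genuine value at \<open>u\<close>, not
    \<open>undefined\<close>.\<close>
  have covered_in: "u \<in> A" if "covered_by P v = {u}" for u v
    using that P(1) by (fastforce simp: covered_by_def underS_def)
  show ?thesis
  proof (rule bij_betw_byWitness[where f' = ?dag])
    show "\<forall>D\<in>?\<D>. ?dag (?par D) = D"
      by auto
    show "\<forall>f\<in>?\<F>. ?par (?dag f) = f"
      by (auto simp: extensional_def fun_eq_iff)
    show "?par ` ?\<D> \<subseteq> ?\<F>"
    proof (rule image_subsetI)
      fix D assume "D \<in> ?\<D>"
      then have D: "D \<subseteq> A \<times> A" "acyclic D" "Id_on A \<union> D\<^sup>+ = P"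
        and nc: "\<not> covered_edge D a b" for a b
        by auto
      have R: "covered_by P v \<subseteq> D\<inverse> `` {v}" "D\<inverse> `` {v} \<subseteq> underS P v" if "v \<in> A" for v
        using that generates_order_iff[OF assms D(1)] D by auto
      have "D\<inverse> `` {v} \<in> parent_choices P v (?par D)" if "v \<in> A" for v
      proof -
        have "D\<inverse> `` {v} \<noteq> insert u (?par D u \<inter> underS P u)" if u: "covered_by P v = {u}" for u
        proof -
          have "?par D u \<inter> underS P u = D\<inverse> `` {u}"
            using R(2) covered_in[OF u] by auto
          then show ?thesis
            using nc[of u v] u covered_edge_iff[OF assms D] by simp
        qed
        then show ?thesis
          using R[OF that] by (auto simp: parent_choices_def)
      qed
      then show "?par D \<in> ?\<F>"
        by simp
    qed
    show "?dag ` ?\<F> \<subseteq> ?\<D>"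
    proof (rule image_subsetI)
      fix f assume f: "f \<in> ?\<F>"
      let ?D = "?dag f"
      have par: "?D\<inverse> `` {v} = f v" if "v \<in> A" for v
        using that by auto
      have R: "covered_by P v \<subseteq> f v" "f v \<subseteq> underS P v" if "v \<in> A" for v
        using f that by (auto simp: parent_choices_def)
      have sub: "?D \<subseteq> A \<times> A"
        using R(2) P(1) by (fastforce simp: underS_def)
      have gen: "acyclic ?D" "Id_on A \<union> ?D\<^sup>+ = P"
        using generates_order_iff[OF assms sub] R by (auto simp: par)
      have "\<not> covered_edge ?D u v" for u v
      proof
        assume cov: "covered_edge ?D u v"
        then have u: "covered_by P v = {u}" and eq: "?D\<inverse> `` {v} = insert u (?D\<inverse> `` {u})"
          using covered_edge_iff[OF assms sub gen] by auto
        have A: "u \<in> A" "v \<in> A"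
          using cov sub by (auto simp: covered_edge_def)
        then have "f v = insert u (f u \<inter> underS P u)"
          using eq R(2)[OF A(1)] by (auto simp: par)
        moreover have "f v \<in> parent_choices P v f"
          using f A(2) by blast
        ultimately show False
          using u by (auto simp: parent_choices_def)
      qed
      then show "?D \<in> ?\<D>"
        using sub gen by blast
    qed
  qed
qed

section \<open>From parent maps to the sum over all orders\<close>

lemma card_dags_generating:
  assumes "finite A" and po: "partial_order_on A P"
  shows "card {D. D \<subseteq> A \<times> A \<and> acyclic D \<and> (\<forall>a b. \<not> covered_edge D a b) \<and> Id_on A \<union> D\<^sup>+ = P} =
    (\<Prod>v\<in>A. 2 ^ (card (underS P v) - card (covered_by P v))
       - (if card (covered_by P v) = 1 then 1 else 0))"
proof -
  note P = partial_order_onD[OF po]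
  have "card {f \<in> extensional A. \<forall>v\<in>A. f v \<in> parent_choices P v f} =
      (\<Prod>v\<in>A. 2 ^ (card (underS P v) - card (covered_by P v))
       - (if card (covered_by P v) = 1 then 1 else 0))"
  \<comment> \<open>The dependency relation is the strict order: the set excluded at
    \<open>v\<close> involves only the value at the element covered by \<open>v\<close>.\<close>
  proof (rule conjunct2[OF card_dependent_choices])
    show "acyclic (P - Id)"
      using acyclic_strict_order[OF po] .
    show "finite (parent_choices P v f)" for v f
      by (rule finite_subset[of _ "Pow (underS P v)"])
        (auto simp: parent_choices_def finite_underS[OF assms])
    fix v and f g :: "'a \<Rightarrow> 'a set"
    assume eq: "\<And>u. u \<in> A \<Longrightarrow> (u, v) \<in> P - Id \<Longrightarrow> f u = g u"
    have "f u = g u" if "covered_by P v = {u}" for u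
    proof -
      have "u \<in> underS P v"
        using that covered_by_subset[of P v] by simp
      then show ?thesis
        using eq P(1) by (auto simp: underS_def)
    qed
    then have "{insert u (f u \<inter> underS P u) | u. covered_by P v = {u}} =
        {insert u (g u \<inter> underS P u) | u. covered_by P v = {u}}"
      by metis
    then show "parent_choices P v f = parent_choices P v g"
      by (simp add: parent_choices_def)
  qed (use assms card_parent_choices[OF assms] in auto)
  then show ?thesis
    using bij_betw_same_card[OF bij_betw_parent_maps[OF assms]] by simp
qed

theorem proposition16:
  fixes n :: nat
  assumes "n \<ge> 1"
  shows "int (card {C \<in> markov_classes n. card C = 1}) =
    (\<Sum>P\<in>posets n. \<Prod>v\<in>{1..n}.
       (2 ^ (card (underS P v) - card (covered_by P v))
          - (if card (covered_by P v) = 1 then 1 else 0)))"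
proof -
  let ?R = "{D \<in> dags n. \<forall>a b. \<not> covered_edge D a b}"
  \<comment> \<open>Unlike \<open>D\<^sup>*\<close>, this adds no reflexive pairs outside
    \<open>{1..n}\<close>.\<close>
  let ?gen = "\<lambda>D. Id_on {1..n} \<union> D\<^sup>+"
  have "finite ?R"
    using finite_dags by auto
  moreover have "?gen ` ?R \<subseteq> posets n"
    using partial_order_on_generated by (auto simp: posets_def dags_def)
  ultimately have "card ?R = (\<Sum>P\<in>posets n. card {D \<in> ?R. ?gen D = P})"
    using sum.group[of ?R "posets n" ?gen "\<lambda>_. 1 :: nat"] finite_posets by simp
  also have "\<dots> = (\<Sum>P\<in>posets n. \<Prod>v\<in>{1..n}.
      2 ^ (card (underS P v) - card (covered_by P v))
        - (if card (covered_by P v) = 1 then 1 else 0))"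
  proof (rule sum.cong)
    fix P assume "P \<in> posets n"
    moreover have "{D \<in> ?R. ?gen D = P} = {D. D \<subseteq> {1..n} \<times> {1..n} \<and> acyclic D \<and>
        (\<forall>a b. \<not> covered_edge D a b) \<and> ?gen D = P}"
      by (auto simp: dags_def)
    ultimately show "card {D \<in> ?R. ?gen D = P} = (\<Prod>v\<in>{1..n}.
        2 ^ (card (underS P v) - card (covered_by P v))
          - (if card (covered_by P v) = 1 then 1 else 0))"
      using card_dags_generating[of "{1..n}" P] by (simp add: posets_def)
  qed simp
  finally have "card ?R = \<dots>" .
  \<comment> \<open>A power of two is at least 1, so the subtraction on naturals does not truncate
    and agrees with the one on integers.\<close>
  moreover have "int (2 ^ k - (if b then 1 else 0)) = 2 ^ k - (if b then 1 else 0)" for k b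
    by (simp add: of_nat_diff)
  ultimately show ?thesis
    unfolding card_singleton_markov_classes by (simp only: of_nat_sum of_nat_prod)
qed

end
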